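(* For all positive integers $k, n$, $AT(C_{2k+1} \square P_n) = 3$. Consequently, $C_{2k+1} \square P_n$ is chromatic-choosable, i.e. $\chi(C_{2k+1} \square P_n) = \chi_\ell(C_{2k+1} \square P_n)$.
   Context: All graphs are finite and simple, and digraphs are simple. $C_m$ denotes the cycle on $m$ vertices and $P_n$ the path on $n$ vertices. The Cartesian product $G \square H$ has vertex set $V(G)\times V(H)$, with $(u,v)$ adjacent to $(u',v')$ iff either $u=u'$ and $vv'\in E(H)$, or $v=v'$ and $uu'\in E(G)$. A circulation contained in a digraph $D$ is a spanning subdigraph $E$ of $D$ such that $d^-_E(v)=d^+_E(v)$ (indegree equals outdegree in $E$) for every $v\in V(D)$; it is even (resp. odd) if it has an even (resp. odd) number of edges (the edgeless circulation is even). The Alon-Tarsi number $AT(G)$ is the smallest $k$ for which there is an orientation $D$ of $G$ with maximum indegree $k-1$ such that the number of even circulations and the number of odd circulations contained in $D$ are different. $\chi(G)$ is the chromatic number and $\chi_\ell(G)$ is the list chromatic number: the smallest $k$ such that for every assignment $L$ of lists of colors to the vertices with $|L(v)|\ge k$ for all $v$, there is a proper coloring $f$ of $G$ with $f(v)\in L(v)$ for all $v$. A graph $G$ is chromatic-choosable if $\chi(G)=\chi_\ell(G)$. *)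

theory Defs
  imports "Graph_Theory.Graph_Theory"
begin

text \<open>
  A finite simple graph is a symmetric loop-free finite digraph without parallel arcs, i.e. a
  \<^locale>\<open>pair_graph\<close>: the edge \<open>uv\<close> is the pair of arcs \<open>(u, v)\<close> and \<open>(v, u)\<close>.
\<close>

text \<open>Meaningful for \<open>m \<ge> 3\<close>: for \<open>m = 1\<close> there would be a loop.\<close>

definition cycle_graph :: "nat \<Rightarrow> nat pair_pre_digraph" where
  "cycle_graph m = \<lparr> pverts = {..<m},
     parcs = {(i, j). i < m \<and> j < m \<and> (j = Suc i mod m \<or> i = Suc j mod m)} \<rparr>"

definition path_graph :: "nat \<Rightarrow> nat pair_pre_digraph" where
  "path_graph n = \<lparr> pverts = {..<n},
     parcs = {(i, j). i < n \<and> j < n \<and> (j = Suc i \<or> i = Suc j)} \<rparr>"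

definition cartesian_product ::
    "'a pair_pre_digraph \<Rightarrow> 'b pair_pre_digraph \<Rightarrow> ('a \<times> 'b) pair_pre_digraph"
    (infixl "\<box>" 70) where
  "G \<box> H = \<lparr> pverts = pverts G \<times> pverts H,
     parcs = {((u, v), (u', v')) | u v u' v'.
       (u = u' \<and> u \<in> pverts G \<and> (v, v') \<in> parcs H) \<or>
       (v = v' \<and> v \<in> pverts H \<and> (u, u') \<in> parcs G)} \<rparr>"

definition orientation_of :: "'a pair_pre_digraph \<Rightarrow> 'a pair_pre_digraph \<Rightarrow> bool" where
  "orientation_of D G \<longleftrightarrow> pverts D = pverts G \<and> parcs D \<subseteq> parcs G \<and>
     (\<forall>(u, v) \<in> parcs G. (u, v) \<in> parcs D \<longleftrightarrow> (v, u) \<notin> parcs D)"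

definition circulation_in :: "'a pair_pre_digraph \<Rightarrow> 'a pair_pre_digraph \<Rightarrow> bool" where
  "circulation_in E D \<longleftrightarrow> spanning E D \<and> (\<forall>v \<in> pverts D. in_degree E v = out_degree E v)"

definition even_circulations :: "'a pair_pre_digraph \<Rightarrow> 'a pair_pre_digraph set" where
  "even_circulations D = {E. circulation_in E D \<and> even (card (parcs E))}"

definition odd_circulations :: "'a pair_pre_digraph \<Rightarrow> 'a pair_pre_digraph set" where
  "odd_circulations D = {E. circulation_in E D \<and> odd (card (parcs E))}"

definition max_indegree :: "'a pair_pre_digraph \<Rightarrow> nat" where
  "max_indegree D = Max (in_degree D ` pverts D)"

text \<open>
  Maximum indegree \<open>k - 1\<close> is written \<open>max_indegree D + 1 = k\<close>, since truncated subtraction would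
  admit \<open>k = 0\<close> for a digraph without arcs. On a nonempty finite graph the set under
  the \<open>LEAST\<close> is nonempty: an acyclic orientation contains only the edgeless circulation.
\<close>

definition AT :: "'a pair_pre_digraph \<Rightarrow> nat" where
  "AT G = (LEAST k. \<exists>D. orientation_of D G \<and> max_indegree D + 1 = k \<and>
     card (even_circulations D) \<noteq> card (odd_circulations D))"

definition proper_coloring :: "'a pair_pre_digraph \<Rightarrow> ('a \<Rightarrow> nat) \<Rightarrow> bool" where
  "proper_coloring G f \<longleftrightarrow> (\<forall>(u, v) \<in> parcs G. f u \<noteq> f v)"

definition chromatic_number :: "'a pair_pre_digraph \<Rightarrow> nat" where
  "chromatic_number G = (LEAST k. \<exists>f. proper_coloring G f \<and> (\<forall>v \<in> pverts G. f v < k))"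

text \<open>
  Lists are finite (\<open>card\<close> of an infinite set is \<open>0\<close>). Colors are natural numbers, which is no
  restriction: finitely many finite lists involve only finitely many colors.
\<close>

definition list_chromatic_number :: "'a pair_pre_digraph \<Rightarrow> nat" where
  "list_chromatic_number G = (LEAST k. \<forall>L :: 'a \<Rightarrow> nat set.
     (\<forall>v \<in> pverts G. finite (L v) \<and> k \<le> card (L v)) \<longrightarrow>
     (\<exists>f. proper_coloring G f \<and> (\<forall>v \<in> pverts G. f v \<in> L v)))"

definition chromatic_choosable :: "'a pair_pre_digraph \<Rightarrow> bool" where
  "chromatic_choosable G \<longleftrightarrow> chromatic_number G = list_chromatic_number G"

lemma pair_graph_cycle_graph:
  assumes "3 \<le> m"
  shows "pair_graph (cycle_graph m)"
proof
  show "finite (parcs (cycle_graph m))"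
    by (rule finite_subset[of _ "{..<m} \<times> {..<m}"]) (auto simp: cycle_graph_def)
  have "Suc i mod m \<noteq> i" if "i < m" for i
    using that assms by (cases "Suc i = m") auto
  then show "fst e \<noteq> snd e" if "e \<in> parcs (cycle_graph m)" for e
    using that by (fastforce simp: cycle_graph_def)
qed (auto simp: cycle_graph_def symmetric_def sym_def)

lemma pair_graph_path_graph: "pair_graph (path_graph n)"
proof
  show "finite (parcs (path_graph n))"
    by (rule finite_subset[of _ "{..<n} \<times> {..<n}"]) (auto simp: path_graph_def)
qed (auto simp: path_graph_def symmetric_def sym_def)

lemma pair_graph_cartesian_product:
  assumes "pair_graph G" "pair_graph H"
  shows "pair_graph (G \<box> H)"
proof -
  interpret G: pair_graph G by fact
  interpret H: pair_graph H by fact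
  show ?thesis
  proof
    show "finite (parcs (G \<box> H))"
      by (rule finite_subset[of _ "(pverts G \<times> pverts H) \<times> (pverts G \<times> pverts H)"])
        (auto simp: cartesian_product_def dest: G.wellformed' H.wellformed')
  qed (auto simp: cartesian_product_def symmetric_def sym_def
      dest: G.wellformed' H.wellformed' G.no_loops' H.no_loops'
      intro: G.arcs_symmetric H.arcs_symmetric)
qed

end

theory Submission
  imports Defs
begin

text \<open>
  Choosability is shown layer by layer. An odd cycle whose 2-element lists are not all equal has at
  least two colorings, and at most one coloring of a layer cuts the 3-element lists of the next
  layer down to equal 2-element lists; so one can always choose a coloring after which the next layer
  is again colorable.

  For the upper bound on \<open>AT\<close> it suffices to find an orientation with an odd number of circulations.
  Reversing circulations shows that this number depends only on the indegrees: it counts the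
  orientations with the same indegrees. Let every indegree be 2, except that in the bottom layer it is
  1 at all columns but \<open>f\<close>, and in the top layer it is lowered by 1 at column \<open>e \<noteq> f\<close>. Then between
  consecutive layers exactly one vertical edge points down, and a layer with this edge at \<open>x\<close> below and
  at \<open>y\<close> above can be oriented in 1 way if \<open>x \<noteq> y\<close> and in 2 ways if \<open>x = y\<close>. Modulo 2 the transfer matrix
  J - I is idempotent because the cycle is odd, so the number of orientations is odd.

  For the lower bound, if all indegrees are at most 1 then they equal the outdegrees and the graph is an
  odd cycle, where complementation exchanges even and odd circulations.
\<close>

section \<open>List colorings of odd cycles and prisms\<close>

lemma card_2_other:
  assumes "card S = 2"
  obtains b where "b \<in> S" "b \<noteq> a"
  using assms by (metis card_2_iff insertCI)

text \<open>Every two-element list offers a color other than the one just used, so the values of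
  \<open>g\<close> up to \<open>s\<close> can be continued greedily along the path.\<close>

lemma greedy_path_coloring:
  fixes L :: "nat \<Rightarrow> 'c set"
  assumes "\<And>t. t < m \<Longrightarrow> card (L t) = 2"
  shows "\<exists>c. (\<forall>t\<le>s. c t = g t) \<and>
    (\<forall>t. s \<le> t \<and> Suc t < m \<longrightarrow> c (Suc t) \<in> L (Suc t) \<and> c (Suc t) \<noteq> c t)"
  using assms
proof (induction m)
  case 0
  show ?case by (intro exI[of _ g]) auto
next
  case (Suc m)
  obtain c where c: "\<forall>t\<le>s. c t = g t"
    "\<forall>t. s \<le> t \<and> Suc t < m \<longrightarrow> c (Suc t) \<in> L (Suc t) \<and> c (Suc t) \<noteq> c t"
    using Suc.IH Suc.prems less_SucI[of _ m] by auto
  obtain b where b: "b \<in> L m" "b \<noteq> c (m - 1)"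
    using Suc.prems[of m] card_2_other by (metis lessI)
  show ?case
  proof (cases "s < m")
    case True
    then show ?thesis
      using b c by (intro exI[of _ "c(m := b)"]) (auto simp: less_Suc_eq)
  next
    case False
    then show ?thesis using c by (intro exI[of _ c]) auto
  qed
qed

text \<open>In the main case \<open>L (t + 1) = {g t, g (t + 1)}\<close> for all \<open>t\<close>, and a second coloring is obtained from \<open>g\<close>
  by shifting an initial segment by one position. The segment can end at \<open>j + 1\<close> unless
  \<open>g (j + 2) = g j\<close>, and oddness excludes that this happens everywhere.\<close>

lemma odd_cycle_second_coloring_aux:
  fixes L :: "nat \<Rightarrow> 'c set"
  assumes m: "odd m" "1 < m"
    and L: "\<And>t. t < m \<Longrightarrow> card (L t) = 2"
    and ne: "L 0 \<noteq> L (m - 1)"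
  shows "\<exists>c. (\<forall>t<m. c t \<in> L t) \<and> (\<forall>t. Suc t < m \<longrightarrow> c (Suc t) \<noteq> c t) \<and> c (m - 1) \<noteq> c 0 \<and>
    (\<exists>t<m. c t \<noteq> g t)"
proof -
  have "\<not> L 0 \<subseteq> L (m - 1)"
    using ne m L[of 0] L[of "m - 1"] card_subset_eq[of "L (m - 1)" "L 0"]
    by (metis card.infinite diff_less less_trans zero_less_one zero_neq_numeral)
  \<comment> \<open>A coloring starting with \<open>a\<close> is proper on the closing edge from
    \<open>m - 1\<close> to 0 automatically, so only a path remains to be colored.\<close>
  then obtain a where a: "a \<in> L 0" "a \<notin> L (m - 1)" by auto
  have Suc_m: "\<exists>t. m - 1 = Suc t" using m by (intro exI[of _ "m - 2"]) auto
  have finish: ?thesis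
    if c: "c 0 = a" "\<forall>t. Suc t < m \<longrightarrow> c (Suc t) \<in> L (Suc t) \<and> c (Suc t) \<noteq> c t"
      "\<exists>t<m. c t \<noteq> g t" for c
  proof (rule exI[of _ c], intro conjI)
    show mem: "\<forall>t<m. c t \<in> L t"
    proof (intro allI impI)
      fix t assume "t < m"
      then show "c t \<in> L t" using c(1,2) a by (cases t) auto
    qed
    then show "c (m - 1) \<noteq> c 0" using a c(1) m by (metis diff_less less_trans zero_less_one)
  qed (use c in auto)
  obtain c0 where c0: "c0 0 = a" "\<forall>t. Suc t < m \<longrightarrow> c0 (Suc t) \<in> L (Suc t) \<and> c0 (Suc t) \<noteq> c0 t"
    using greedy_path_coloring[of m L 0 "\<lambda>_. a"] L by auto
  show ?thesis
  proof (cases "\<exists>t<m. c0 t \<noteq> g t")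
    case True
    then show ?thesis using finish c0 by blast
  next
    case False
    \<comment> \<open>The greedy coloring agrees with \<open>g\<close>, so \<open>g\<close> itself
      is a proper coloring starting with \<open>a\<close>, and a different one has to be built from
      it.\<close>
    then have g: "g 0 = a" "\<And>t. Suc t < m \<Longrightarrow> g (Suc t) \<in> L (Suc t) \<and> g (Suc t) \<noteq> g t"
      using c0 m by (auto simp: Suc_lessD)
    have g_mem: "g t \<in> L t" if "t < m" for t
      using that g a by (cases t) auto
    show ?thesis
    proof (cases "\<exists>t. Suc t < m \<and> g t \<notin> L (Suc t)")
      case True
      then obtain t where t: "Suc t < m" "g t \<notin> L (Suc t)" by auto
      \<comment> \<open>Since \<open>g t\<close> is missing from the list at \<open>Suc t\<close>,
        the other color \<open>b\<close> of that list is also compatible with \<open>g t\<close>;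
        the greedy continuation then leaves \<open>g\<close>.\<close>
      obtain b where b: "b \<in> L (Suc t)" "b \<noteq> g (Suc t)"
        using card_2_other[OF L[OF t(1)]] by metis
      obtain c where c: "\<forall>u\<le>Suc t. c u = (g(Suc t := b)) u"
        "\<forall>u. Suc t \<le> u \<and> Suc u < m \<longrightarrow> c (Suc u) \<in> L (Suc u) \<and> c (Suc u) \<noteq> c u"
        using greedy_path_coloring[of m L "Suc t" "g(Suc t := b)"] L by blast
      have "c (Suc u) \<in> L (Suc u) \<and> c (Suc u) \<noteq> c u" if "Suc u < m" for u
      proof (cases "Suc t \<le> u")
        case True
        then show ?thesis using c that by auto
      next
        case False
        then show ?thesis using c(1) t b g(2)[OF that] by (cases "u = t") auto
      qed
      moreover have "c (Suc t) \<noteq> g (Suc t)" using c(1) b by auto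
      moreover have "c 0 = a" using c(1) g by auto
      ultimately show ?thesis using finish t(1) by blast
    next
      case False
      then have shift: "\<And>t. Suc t < m \<Longrightarrow> g t \<in> L (Suc t)" by auto
      obtain d where d: "d \<in> L 0" "d \<noteq> a"
        using card_2_other[OF L[of 0]] m by (metis less_trans zero_less_one)
      \<comment> \<open>The shifted coloring starts with \<open>d\<close>, so the closing edge needs
        care. If \<open>g (m - 1) = d\<close>, the whole cycle is shifted: the last color becomes
        \<open>g (m - 2)\<close>, which differs from \<open>d\<close>. Otherwise the last color
        stays \<open>g (m - 1)\<close>, and the shift must end where \<open>g j\<close> and
        \<open>g (j + 2)\<close> differ.\<close>
      have "\<exists>j. Suc j < m \<and> (if Suc (Suc j) = m then g (m - 1) = d
          else g j \<noteq> g (Suc (Suc j)) \<and> g (m - 1) \<noteq> d)"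
      proof (cases "g (m - 1) = d")
        case True
        moreover have "Suc (m - 2) < m" "Suc (Suc (m - 2)) = m" using m by linarith+
        ultimately show ?thesis by (intro exI[of _ "m - 2"]) simp
      next
        case gd: False
        show ?thesis
        proof (rule ccontr)
          assume none: "\<not> ?thesis"
          have per: "g (Suc (Suc j)) = g j" if "Suc (Suc j) < m" for j
          proof (rule ccontr)
            assume "g (Suc (Suc j)) \<noteq> g j"
            then have "Suc j < m \<and> (if Suc (Suc j) = m then g (m - 1) = d
                else g j \<noteq> g (Suc (Suc j)) \<and> g (m - 1) \<noteq> d)"
              using that gd by simp
            with none show False by blast
          qed
          \<comment> \<open>Without such a \<open>j\<close> the coloring has period 2; as
            \<open>m - 1\<close> is even, \<open>a\<close> would be the color at
            \<open>m - 1\<close>, whose list does not contain it.\<close>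
          have "2 * i < m \<Longrightarrow> g (2 * i) = a" for i
            by (induction i) (use g(1) per in auto)
          from this[of "(m - 1) div 2"] m have "g (m - 1) = a" by simp
          then show False using g_mem[of "m - 1"] a m by auto
        qed
      qed
      then obtain j where j: "Suc j < m" "if Suc (Suc j) = m then g (m - 1) = d
          else g j \<noteq> g (Suc (Suc j)) \<and> g (m - 1) \<noteq> d" by blast
      define c where "c t = (case t of 0 \<Rightarrow> d | Suc u \<Rightarrow> if u \<le> j then g u else g t)" for t
      have "c t \<in> L t" if "t < m" for t
        using that d shift g_mem by (auto simp: c_def split: nat.split)
      moreover have "c (Suc t) \<noteq> c t" if "Suc t < m" for t
      proof (cases t)
        case 0
        then show ?thesis using d g by (auto simp: c_def)
      next
        case (Suc u)
        then show ?thesis using that j(2) g(2)[of u] g(2)[of "Suc u"]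
          by (auto simp: c_def not_less_eq_eq le_Suc_eq split: if_splits dest: le_antisym)
      qed
      moreover have "c (m - 1) \<noteq> c 0"
      proof (cases "Suc (Suc j) = m")
        case True
        then show ?thesis using j g(2)[of j] by (auto simp: c_def)
      next
        case False
        with j obtain u where u: "m - 1 = Suc u" "j < u"
          by (metis Suc_lessI Suc_less_eq Suc_m diff_Suc_1 less_imp_Suc_add)
        then show ?thesis using j False by (auto simp: c_def)
      qed
      moreover have "\<exists>t<m. c t \<noteq> g t" using d g m by (intro exI[of _ 0]) (auto simp: c_def)
      ultimately show ?thesis by blast
    qed
  qed
qed

lemma Suc_mod_eq: "i < m \<Longrightarrow> Suc i mod m = (if Suc i = m then 0 else Suc i)"
  by auto

lemma constant_around_cycle:
  assumes step: "\<And>i. i < m \<Longrightarrow> P (Suc i mod m) = P i" and "j < m"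
  shows "P j = P 0"
  using \<open>j < m\<close>
proof (induction j)
  case (Suc j)
  then show ?case using step[of j] by auto
qed simp

text \<open>A rotation moves two consecutive unequal lists to the positions \<open>m - 1\<close> and
  0. Avoiding an arbitrary \<open>g\<close> is the form in which the existence of two colorings is
  used.\<close>

lemma odd_cycle_second_coloring:
  fixes L :: "nat \<Rightarrow> 'c set"
  assumes m: "odd m" "1 < m"
    and L: "\<And>i. i < m \<Longrightarrow> card (L i) = 2"
    and ne: "\<exists>i<m. L (Suc i mod m) \<noteq> L i"
  shows "\<exists>c. (\<forall>i<m. c i \<in> L i) \<and> (\<forall>i<m. c (Suc i mod m) \<noteq> c i) \<and> (\<exists>i<m. c i \<noteq> g i)"
proof -
  obtain i where i: "i < m" "L (Suc i mod m) \<noteq> L i" using ne by auto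
  define rot where "rot t = (t + Suc i) mod m" for t
  define inv where "inv p = (p + (m - Suc i)) mod m" for p
  have bound: "rot t < m" "inv t < m" for t using m by (auto simp: rot_def inv_def)
  have rot_inv: "rot (inv p) = p" if "p < m" for p
  proof -
    have "rot (inv p) = (p + (m - Suc i) + Suc i) mod m"
      unfolding rot_def inv_def by (rule mod_add_left_eq)
    also have "p + (m - Suc i) + Suc i = p + m" using i by simp
    finally show ?thesis using that by simp
  qed
  have inv_rot: "inv (rot p) = p" if "p < m" for p
  proof -
    have "inv (rot p) = (p + Suc i + (m - Suc i)) mod m"
      unfolding rot_def inv_def by (rule mod_add_left_eq)
    also have "p + Suc i + (m - Suc i) = p + m" using i by simp
    finally show ?thesis using that by simp
  qed
  have rot_ends: "rot 0 = Suc i mod m" "rot (m - 1) = i" using i by (auto simp: rot_def)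
  have inv_Suc: "inv (Suc p mod m) = Suc (inv p) mod m" for p
    by (simp add: inv_def mod_simps)
  obtain c where c: "\<forall>t<m. c t \<in> L (rot t)" "\<forall>t. Suc t < m \<longrightarrow> c (Suc t) \<noteq> c t"
      "c (m - 1) \<noteq> c 0" "\<exists>t<m. c t \<noteq> g (rot t)"
    using odd_cycle_second_coloring_aux[of m "\<lambda>t. L (rot t)" "\<lambda>t. g (rot t)"] m L bound i
    unfolding rot_ends by blast
  have "c (inv p) \<in> L p" if "p < m" for p
    using c(1) bound(2)[of p] rot_inv[OF that] by metis
  moreover have "c (inv (Suc p mod m)) \<noteq> c (inv p)" if "p < m" for p
    using c(2,3) bound(2)[of p] unfolding inv_Suc by (auto simp: Suc_mod_eq)
  moreover have "\<exists>p<m. c (inv p) \<noteq> g p"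
    using c(4) inv_rot bound(1) by metis
  ultimately show ?thesis by (intro exI[of _ "\<lambda>p. c (inv p)"]) blast
qed

text \<open>Where three colors are available, the pair can be chosen to avoid some color of the pair
  in the next column, so these two pairs differ.\<close>

lemma unequal_pairs:
  fixes A :: "nat \<Rightarrow> 'c set"
  assumes m: "1 < m" and A: "\<And>i. i < m \<Longrightarrow> 2 \<le> card (A i)"
    and i0: "i0 < m" "3 \<le> card (A i0)"
  shows "\<exists>M. (\<forall>i<m. M i \<subseteq> A i \<and> card (M i) = 2) \<and> (\<exists>i<m. M (Suc i mod m) \<noteq> M i)"
proof -
  have "\<forall>i. \<exists>S. i < m \<longrightarrow> S \<subseteq> A i \<and> card S = 2"
    using A obtain_subset_with_card_n by metis
  then obtain N where N: "\<And>i. i < m \<Longrightarrow> N i \<subseteq> A i \<and> card (N i) = 2" by metis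
  define s where "s = Suc i0 mod m"
  have s: "s < m" "s \<noteq> i0" using m i0(1) by (auto simp: s_def Suc_mod_eq)
  obtain x where x: "x \<in> N s" using N[OF s(1)] by fastforce
  have "2 \<le> card (A i0 - {x})" using i0(2) by (auto simp: card_Diff_singleton_if)
  then obtain S where S: "S \<subseteq> A i0 - {x}" "card S = 2"
    by (metis obtain_subset_with_card_n)
  have "(N(i0 := S)) (Suc i0 mod m) \<noteq> (N(i0 := S)) i0"
    using s x S unfolding s_def[symmetric] by auto
  then show ?thesis using N S i0(1) by (intro exI[of _ "N(i0 := S)"]) auto
qed

text \<open>A coloring that admits no such \<open>M\<close> uses only colors from the lists and
  leaves the same pair in every column. Suppose \<open>g\<close> and \<open>c\<close> are both of
  this kind and differ at \<open>i\<close>. Then \<open>c i\<close> lies in the common pair left by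
  \<open>g\<close>, hence in every list, but not in the common pair left by \<open>c\<close>. So
  \<open>c\<close> has the constant value \<open>c i\<close> and is not proper. Excluding a single
  \<open>g\<close> is therefore enough.\<close>

lemma next_layer_lists:
  fixes L :: "nat \<Rightarrow> 'c set"
  assumes m: "1 < m" and L: "\<And>i. i < m \<Longrightarrow> card (L i) = 3"
  shows "\<exists>g. \<forall>c. (\<forall>i<m. c (Suc i mod m) \<noteq> c i) \<longrightarrow> (\<exists>i<m. c i \<noteq> g i) \<longrightarrow>
    (\<exists>M. (\<forall>i<m. M i \<subseteq> L i - {c i} \<and> card (M i) = 2) \<and> (\<exists>i<m. M (Suc i mod m) \<noteq> M i))"
proof -
  define good where "good c \<longleftrightarrow>
    (\<exists>M. (\<forall>i<m. M i \<subseteq> L i - {c i} \<and> card (M i) = 2) \<and> (\<exists>i<m. M (Suc i mod m) \<noteq> M i))" for c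
  have card2: "2 \<le> card (L i - {c i})" if "i < m" for i c
    using L[OF that] by (auto simp: card_Diff_singleton_if)
  have bad: "c i \<in> L i \<and> L i - {c i} = L 0 - {c 0}" if "\<not> good c" "i < m" for c i
  proof -
    have mem: "c j \<in> L j" if "j < m" for j
    proof (rule ccontr)
      assume "c j \<notin> L j"
      then have "3 \<le> card (L j - {c j})" using L[OF that] by simp
      with m card2 that have "good c"
        unfolding good_def by (intro unequal_pairs[where ?i0.0 = j]) auto
      then show False using \<open>\<not> good c\<close> by simp
    qed
    have "L j - {c j} = L 0 - {c 0}" if "j < m" for j
    proof (rule constant_around_cycle[where P = "\<lambda>j. L j - {c j}", OF _ that])
      fix j assume "j < m"
      show "L (Suc j mod m) - {c (Suc j mod m)} = L j - {c j}"
      proof (rule ccontr)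
        assume "\<not> ?thesis"
        moreover have "card (L j - {c j}) = 2" if "j < m" for j
          using L[OF that] mem[OF that] by simp
        ultimately have "good c"
          unfolding good_def using \<open>j < m\<close> by (intro exI[of _ "\<lambda>j. L j - {c j}"]) auto
        then show False using \<open>\<not> good c\<close> by simp
      qed
    qed
    then show ?thesis using mem that by blast
  qed
  have "\<exists>g. \<forall>c. (\<forall>i<m. c (Suc i mod m) \<noteq> c i) \<longrightarrow> (\<exists>i<m. c i \<noteq> g i) \<longrightarrow> good c"
  proof (cases "\<exists>g. \<not> good g")
    case True
    then obtain g where g: "\<not> good g" by blast
    show ?thesis
    proof (rule exI[of _ g], intro allI impI)
      fix c assume c: "\<forall>i<m. c (Suc i mod m) \<noteq> c i" "\<exists>i<m. c i \<noteq> g i"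
      then obtain i where i: "i < m" "c i \<noteq> g i" by blast
      show "good c"
      proof (rule ccontr)
        assume nc: "\<not> good c"
        have const: "c j = c i" if "j < m" for j
        proof -
          have "c i \<in> L i - {g i}" using bad[OF nc i(1)] i(2) by simp
          then have "c i \<in> L j - {g j}" using bad[OF g i(1)] bad[OF g that] by simp
          moreover have "c i \<notin> L i - {c i}" by simp
          then have "c i \<notin> L j - {c j}" using bad[OF nc i(1)] bad[OF nc that] by simp
          ultimately show ?thesis by simp
        qed
        have "c (Suc i mod m) = c i" using const m by simp
        then show False using c(1) i(1) by simp
      qed
    qed
  qed blast
  then show ?thesis unfolding good_def .
qed

text \<open>Induction from the bottom layer upwards. The pairs \<open>M\<close> stand for what is
  left of the lists of the current layer once the layer below is colored; being unequal, they leave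
  a choice of coloring.\<close>

lemma odd_prism_coloring_aux:
  fixes L :: "nat \<Rightarrow> nat \<Rightarrow> 'c set"
  assumes m: "odd m" "1 < m"
    and "\<And>i j. i < m \<Longrightarrow> j \<le> n \<Longrightarrow> card (L j i) = 3"
    and "\<And>i. i < m \<Longrightarrow> M i \<subseteq> L 0 i \<and> card (M i) = 2"
    and "\<exists>i<m. M (Suc i mod m) \<noteq> M i"
  shows "\<exists>F. (\<forall>i<m. F 0 i \<in> M i) \<and>
    (\<forall>j\<le>n. \<forall>i<m. F j i \<in> L j i \<and> F j (Suc i mod m) \<noteq> F j i) \<and>
    (\<forall>j<n. \<forall>i<m. F (Suc j) i \<noteq> F j i)"
  using assms(3-5)
proof (induction n arbitrary: L M)
  case 0
  obtain c where "\<forall>i<m. c i \<in> M i" "\<forall>i<m. c (Suc i mod m) \<noteq> c i"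
    using odd_cycle_second_coloring[OF m _ 0(3)] 0(2) by blast
  then show ?case using 0(2) by (intro exI[of _ "\<lambda>j. c"]) auto
next
  case (Suc n)
  \<comment> \<open>The coloring to avoid depends only on the lists of layer 1, so it is fixed
    before layer 0 is colored.\<close>
  obtain g where g: "\<And>c. (\<forall>i<m. c (Suc i mod m) \<noteq> c i) \<Longrightarrow> (\<exists>i<m. c i \<noteq> g i) \<Longrightarrow>
    (\<exists>M. (\<forall>i<m. M i \<subseteq> L 1 i - {c i} \<and> card (M i) = 2) \<and> (\<exists>i<m. M (Suc i mod m) \<noteq> M i))"
    using next_layer_lists[OF m(2), of "L 1"] Suc.prems(1) by auto
  obtain c where c: "\<forall>i<m. c i \<in> M i" "\<forall>i<m. c (Suc i mod m) \<noteq> c i" "\<exists>i<m. c i \<noteq> g i"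
    using odd_cycle_second_coloring[OF m _ Suc.prems(3), of g] Suc.prems(2) by blast
  obtain M' where M': "\<forall>i<m. M' i \<subseteq> L 1 i - {c i} \<and> card (M' i) = 2"
      "\<exists>i<m. M' (Suc i mod m) \<noteq> M' i"
    using g[OF c(2,3)] by blast
  have "\<exists>F. (\<forall>i<m. F 0 i \<in> M' i) \<and>
    (\<forall>j\<le>n. \<forall>i<m. F j i \<in> L (Suc j) i \<and> F j (Suc i mod m) \<noteq> F j i) \<and>
    (\<forall>j<n. \<forall>i<m. F (Suc j) i \<noteq> F j i)"
    by (rule Suc.IH) (use Suc.prems(1) M' in auto)
  then obtain F where F: "\<forall>i<m. F 0 i \<in> M' i"
    "\<forall>j\<le>n. \<forall>i<m. F j i \<in> L (Suc j) i \<and> F j (Suc i mod m) \<noteq> F j i"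
    "\<forall>j<n. \<forall>i<m. F (Suc j) i \<noteq> F j i" by blast
  define F' where "F' = case_nat c F"
  have "\<forall>i<m. F' 0 i \<in> M i" using c by (simp add: F'_def)
  moreover have "F' j i \<in> L j i \<and> F' j (Suc i mod m) \<noteq> F' j i" if "j \<le> Suc n" "i < m" for i j
    using that c F(2) Suc.prems(2)[of i] by (cases j) (auto simp: F'_def)
  moreover have "F' (Suc j) i \<noteq> F' j i" if "j < Suc n" "i < m" for i j
  proof (cases j)
    case 0
    then show ?thesis using that F(1) M'(1) by (simp add: F'_def) blast
  next
    case (Suc l)
    then show ?thesis using that F(3) by (simp add: F'_def)
  qed
  ultimately show ?case by blast
qed

lemma odd_prism_list_coloring:
  fixes L :: "nat \<Rightarrow> nat \<Rightarrow> 'c set"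
  assumes m: "odd m" "1 < m"
    and L: "\<And>i j. i < m \<Longrightarrow> j \<le> n \<Longrightarrow> 3 \<le> card (L j i)"
  shows "\<exists>F. (\<forall>j\<le>n. \<forall>i<m. F j i \<in> L j i \<and> F j (Suc i mod m) \<noteq> F j i) \<and>
    (\<forall>j<n. \<forall>i<m. F (Suc j) i \<noteq> F j i)"
proof -
  have "\<forall>j i. \<exists>S. i < m \<longrightarrow> j \<le> n \<longrightarrow> S \<subseteq> L j i \<and> card S = 3"
    using L obtain_subset_with_card_n by metis
  then obtain K where K: "\<And>i j. i < m \<Longrightarrow> j \<le> n \<Longrightarrow> K j i \<subseteq> L j i \<and> card (K j i) = 3"
    by metis
  have "\<exists>M. (\<forall>i<m. M i \<subseteq> K 0 i \<and> card (M i) = 2) \<and> (\<exists>i<m. M (Suc i mod m) \<noteq> M i)"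
    by (rule unequal_pairs[of _ _ 0]) (use m K[of _ 0] in auto)
  then obtain M where M: "\<And>i. i < m \<Longrightarrow> M i \<subseteq> K 0 i \<and> card (M i) = 2"
      "\<exists>i<m. M (Suc i mod m) \<noteq> M i" by blast
  obtain F where F: "\<forall>j\<le>n. \<forall>i<m. F j i \<in> K j i \<and> F j (Suc i mod m) \<noteq> F j i"
    "\<forall>j<n. \<forall>i<m. F (Suc j) i \<noteq> F j i"
    using odd_prism_coloring_aux[of m n K M] m M K by blast
  then show ?thesis using K by (intro exI[of _ F]) blast
qed

lemma odd_cycle_not_2_colorable:
  fixes c :: "nat \<Rightarrow> nat"
  assumes "odd m" and c: "\<And>i. i < m \<Longrightarrow> c (Suc i mod m) \<noteq> c i" "\<And>i. i < m \<Longrightarrow> c i < k"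
  shows "3 \<le> k"
proof (rule ccontr)
  assume "\<not> 3 \<le> k"
  then have c2: "c i < 2" if "i < m" for i using c(2)[OF that] by simp
  have "0 < m" using \<open>odd m\<close> by (rule odd_pos)
  have par: "even (c i) \<longleftrightarrow> (even i \<longleftrightarrow> even (c 0))" if "i < m" for i
    using that
  proof (induction i)
    case 0
    show ?case by simp
  next
    case (Suc i)
    have "c (Suc i) \<noteq> c i" using c(1)[of i] Suc.prems by simp
    moreover have "c i < 2" "c (Suc i) < 2" using c2 Suc.prems by simp_all
    ultimately have "even (c (Suc i)) \<longleftrightarrow> odd (c i)" by presburger
    then show ?case using Suc.IH Suc.prems by auto
  qed
  have "even (m - 1)" using \<open>odd m\<close> by simp
  then have "even (c (m - 1)) \<longleftrightarrow> even (c 0)" using par[of "m - 1"] \<open>0 < m\<close> by simp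
  moreover have "c 0 \<noteq> c (m - 1)" using c(1)[of "m - 1"] \<open>0 < m\<close> by simp
  moreover have "c 0 < 2" "c (m - 1) < 2" using c2 \<open>0 < m\<close> by simp_all
  ultimately show False by presburger
qed

section \<open>Circulations and orientations with prescribed indegrees\<close>

lemma circulation_in_iff:
  assumes "pair_wf_digraph D"
  shows "circulation_in E D \<longleftrightarrow> pverts E = pverts D \<and> parcs E \<subseteq> parcs D \<and>
    (\<forall>v \<in> pverts D. in_degree E v = out_degree E v)"
proof -
  have "pair_wf_digraph E" if "pverts E = pverts D" "parcs E \<subseteq> parcs D"
    using assms that by (auto simp: pair_wf_digraph_def)
  then show ?thesis
    using assms by (auto simp: circulation_in_def spanning_def subgraph_def wf_digraph_wp_iff)
qed

lemma circulations_split: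
  "{E. circulation_in E D} = even_circulations D \<union> odd_circulations D"
  "even_circulations D \<inter> odd_circulations D = {}"
  by (auto simp: even_circulations_def odd_circulations_def)

lemma orientation_wf:
  assumes "orientation_of D G" "pair_graph G"
  shows "pair_wf_digraph D" "finite (parcs D)" "finite (pverts D)"
proof -
  interpret pair_graph G by fact
  show "pair_wf_digraph D"
    using assms(1) wellformed' by (unfold_locales) (fastforce simp: orientation_of_def)+
  show "finite (parcs D)" "finite (pverts D)"
    using assms(1) by (auto simp: orientation_of_def intro: finite_subset)
qed

lemma in_degree_eq_card: "in_degree (with_proj E) v = card {e \<in> parcs E. snd e = v}"
  and out_degree_eq_card: "out_degree (with_proj E) v = card {e \<in> parcs E. fst e = v}"
  by (auto simp: in_degree_def in_arcs_def out_degree_def out_arcs_def)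

lemma card_snd_converse: "card {e \<in> A\<inverse>. snd e = v} = card {e \<in> A. fst e = v}"
proof -
  have "{e \<in> A\<inverse>. snd e = v} = prod.swap ` {e \<in> A. fst e = v}" by auto
  then show ?thesis by (simp add: card_image)
qed

lemma sum_in_degree:
  assumes "pair_wf_digraph D" "finite (parcs D)" "finite (pverts D)"
  shows "(\<Sum>v\<in>pverts D. in_degree D v) = card (parcs D)"
    and "(\<Sum>v\<in>pverts D. out_degree D v) = card (parcs D)"
proof -
  have "snd ` parcs D \<subseteq> pverts D" "fst ` parcs D \<subseteq> pverts D"
    using assms(1) by (auto simp: pair_wf_digraph_def)
  from sum.group[OF assms(2,3) this(1), of "\<lambda>_. 1 :: nat"]
    sum.group[OF assms(2,3) this(2), of "\<lambda>_. 1 :: nat"]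
  show "(\<Sum>v\<in>pverts D. in_degree D v) = card (parcs D)"
    "(\<Sum>v\<in>pverts D. out_degree D v) = card (parcs D)"
    by (simp_all add: in_degree_eq_card out_degree_eq_card)
qed

lemma degree_orientation:
  assumes "orientation_of D G" "pair_graph G"
  shows "in_degree D v + out_degree D v = in_degree G v"
proof -
  interpret pair_graph G by fact
  have fin: "finite (parcs D)" using orientation_wf[OF assms] by simp
  have "{e \<in> parcs G. snd e = v} = {e \<in> parcs D. snd e = v} \<union> {e \<in> (parcs D)\<inverse>. snd e = v}"
    using assms(1) arcs_symmetric by (fastforce simp: orientation_of_def)
  moreover have "{e \<in> parcs D. snd e = v} \<inter> {e \<in> (parcs D)\<inverse>. snd e = v} = {}"
    using assms(1) by (fastforce simp: orientation_of_def)
  ultimately have "card {e \<in> parcs G. snd e = v} =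
      card {e \<in> parcs D. snd e = v} + card {e \<in> (parcs D)\<inverse>. snd e = v}"
    using fin by (simp add: card_Un_disjoint)
  then show ?thesis by (simp add: in_degree_eq_card out_degree_eq_card card_snd_converse)
qed

section \<open>Reversing circulations\<close>

definition reverse_arcs :: "'a pair_pre_digraph \<Rightarrow> 'a pair_pre_digraph \<Rightarrow> 'a pair_pre_digraph" where
  "reverse_arcs D E = \<lparr> pverts = pverts D, parcs = (parcs D - parcs E) \<union> (parcs E)\<inverse> \<rparr>"

text \<open>The arcs of \<open>E\<close> entering \<open>v\<close> are lost and those leaving it are
  gained, so the indegree is kept exactly where \<open>E\<close> is balanced. The additive form
  avoids truncated subtraction.\<close>

lemma in_degree_reverse_arcs:
  assumes "orientation_of D G" "pair_graph G" "parcs E \<subseteq> parcs D"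
  shows "in_degree (reverse_arcs D E) v + in_degree E v = in_degree D v + out_degree E v"
proof -
  have fin: "finite (parcs D)" "finite (parcs E)"
    using orientation_wf[OF assms(1,2)] assms(3) finite_subset by auto
  let ?I = "\<lambda>A. {e \<in> A. snd e = v}"
  have "?I (parcs (reverse_arcs D E)) = (?I (parcs D) - ?I (parcs E)) \<union> ?I ((parcs E)\<inverse>)"
    by (auto simp: reverse_arcs_def)
  moreover have "(?I (parcs D) - ?I (parcs E)) \<inter> ?I ((parcs E)\<inverse>) = {}"
    using assms(1,3) by (fastforce simp: orientation_of_def)
  ultimately have "card (?I (parcs (reverse_arcs D E))) =
      card (?I (parcs D) - ?I (parcs E)) + card (?I ((parcs E)\<inverse>))"
    using fin by (simp add: card_Un_disjoint)
  moreover have "card (?I (parcs D) - ?I (parcs E)) + card (?I (parcs E)) = card (?I (parcs D))"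
    using fin assms(3) by (subst card_Diff_subset) (auto intro!: card_mono le_add_diff_inverse2)
  ultimately show ?thesis
    by (simp add: in_degree_eq_card out_degree_eq_card card_snd_converse)
qed

text \<open>The inverse map sends \<open>D'\<close> to the arcs of \<open>D\<close> that
  \<open>D'\<close> reverses; equal indegrees make this arc set balanced at every vertex.\<close>

lemma bij_betw_circulations_orientations:
  assumes "orientation_of D G" "pair_graph G"
  shows "bij_betw (reverse_arcs D) {E. circulation_in E D}
    {D'. orientation_of D' G \<and> (\<forall>v \<in> pverts G. in_degree D' v = in_degree D v)}"
proof (rule bij_betw_byWitness[where f' = "\<lambda>D'. \<lparr> pverts = pverts D, parcs = parcs D - parcs D' \<rparr>"])
  interpret pair_graph G by fact
  have D: "pverts D = pverts G" "parcs D \<subseteq> parcs G"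
    "\<And>u v. (u, v) \<in> parcs G \<Longrightarrow> (u, v) \<in> parcs D \<longleftrightarrow> (v, u) \<notin> parcs D"
    using assms(1) by (auto simp: orientation_of_def)
  have asym: "(v, u) \<notin> parcs D" if "(u, v) \<in> parcs D" for u v
    using D that by blast
  note circ = circulation_in_iff[OF orientation_wf(1)[OF assms]]
  have rev: "reverse_arcs D \<lparr> pverts = pverts D, parcs = parcs D - parcs D' \<rparr> = D'"
    if "orientation_of D' G" for D'
  proof (rule pair_pre_digraph.equality)
    show "parcs (reverse_arcs D \<lparr> pverts = pverts D, parcs = parcs D - parcs D' \<rparr>) = parcs D'"
      using that D arcs_symmetric by (fastforce simp: orientation_of_def reverse_arcs_def)
  qed (use that D in \<open>auto simp: reverse_arcs_def orientation_of_def\<close>)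
  show "\<forall>E\<in>{E. circulation_in E D}.
      \<lparr> pverts = pverts D, parcs = parcs D - parcs (reverse_arcs D E) \<rparr> = E"
  proof safe
    fix E assume "circulation_in E D"
    then have E: "pverts E = pverts D" "parcs E \<subseteq> parcs D" by (auto simp: circ)
    then have "(v, u) \<notin> parcs E" if "(u, v) \<in> parcs E" for u v using asym that by blast
    then have "parcs D - parcs (reverse_arcs D E) = parcs E"
      using E(2) by (auto simp: reverse_arcs_def)
    then show "\<lparr> pverts = pverts D, parcs = parcs D - parcs (reverse_arcs D E) \<rparr> = E"
      by (intro pair_pre_digraph.equality) (simp_all add: E(1))
  qed
  show "\<forall>D'\<in>{D'. orientation_of D' G \<and> (\<forall>v\<in>pverts G. in_degree D' v = in_degree D v)}.
      reverse_arcs D \<lparr> pverts = pverts D, parcs = parcs D - parcs D' \<rparr> = D'"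
    using rev by blast
  show "reverse_arcs D ` {E. circulation_in E D} \<subseteq>
      {D'. orientation_of D' G \<and> (\<forall>v\<in>pverts G. in_degree D' v = in_degree D v)}"
  proof safe
    fix E assume "circulation_in E D"
    then have E: "pverts E = pverts D" "parcs E \<subseteq> parcs D"
      "\<And>v. v \<in> pverts D \<Longrightarrow> in_degree E v = out_degree E v" by (auto simp: circ)
    show "orientation_of (reverse_arcs D E) G"
      unfolding orientation_of_def
    proof (intro conjI ballI)
      show "pverts (reverse_arcs D E) = pverts G" by (simp add: reverse_arcs_def D(1))
      show "parcs (reverse_arcs D E) \<subseteq> parcs G"
        using D(2) E(2) arcs_symmetric by (auto simp: reverse_arcs_def)
      fix e assume "e \<in> parcs G"
      obtain u v where e: "e = (u, v)" by fastforce
      have "(u, v) \<in> parcs D \<longleftrightarrow> (v, u) \<notin> parcs D"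
        using \<open>e \<in> parcs G\<close> D(3) e by simp
      then show "case e of (u, v) \<Rightarrow>
          (u, v) \<in> parcs (reverse_arcs D E) \<longleftrightarrow> (v, u) \<notin> parcs (reverse_arcs D E)"
        using E(2) unfolding e reverse_arcs_def by (auto dest: subsetD)
    qed
    fix v assume "v \<in> pverts G"
    then show "in_degree (reverse_arcs D E) v = in_degree D v"
      using in_degree_reverse_arcs[OF assms E(2), of v] E(3)[of v] D(1) by simp
  qed
  show "(\<lambda>D'. \<lparr> pverts = pverts D, parcs = parcs D - parcs D' \<rparr>) `
      {D'. orientation_of D' G \<and> (\<forall>v\<in>pverts G. in_degree D' v = in_degree D v)} \<subseteq>
      {E. circulation_in E D}"
  proof safe
    fix D' assume D': "orientation_of D' G" "\<forall>v\<in>pverts G. in_degree D' v = in_degree D v"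
    let ?E = "\<lparr> pverts = pverts D, parcs = parcs D - parcs D' \<rparr>"
    have "in_degree ?E v = out_degree ?E v" if "v \<in> pverts D" for v
      using in_degree_reverse_arcs[OF assms, of ?E v] rev[OF D'(1)] D'(2) that D(1) by auto
    then show "circulation_in ?E D" by (auto simp: circ)
  qed
qed

text \<open>The bijection with the orientations of equal indegrees makes the total number of
  circulations odd, and an odd total cannot split into two equal parts.\<close>

lemma even_odd_circulations_neq:
  assumes "orientation_of D G" "pair_graph G"
    and "odd (card {D'. orientation_of D' G \<and> (\<forall>v \<in> pverts G. in_degree D' v = in_degree D v)})"
  shows "card (even_circulations D) \<noteq> card (odd_circulations D)"
proof
  assume eq: "card (even_circulations D) = card (odd_circulations D)"
  have odd: "odd (card {E. circulation_in E D})"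
    using assms(3) bij_betw_same_card[OF bij_betw_circulations_orientations[OF assms(1,2)]] by simp
  \<comment> \<open>An infinite set would have cardinality 0, which is even.\<close>
  then have "finite {E. circulation_in E D}" by (metis card.infinite even_zero)
  then have "card {E. circulation_in E D} = card (even_circulations D) + card (odd_circulations D)"
    unfolding circulations_split(1) by (simp add: card_Un_disjoint circulations_split(2))
  with eq odd show False by simp
qed

text \<open>As \<open>D\<close> is itself a circulation, complementation within \<open>D\<close> is
  an involution on circulations; as \<open>D\<close> has an odd number of arcs, it flips
  parity.\<close>

lemma even_odd_circulations_eq:
  assumes wf: "pair_wf_digraph D" and fin: "finite (parcs D)" and "odd (card (parcs D))"
    and bal: "\<And>v. v \<in> pverts D \<Longrightarrow> in_degree D v = out_degree D v"
  shows "card (even_circulations D) = card (odd_circulations D)"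
proof -
  let ?c = "\<lambda>E. \<lparr> pverts = pverts D, parcs = parcs D - parcs E \<rparr>"
  note circ = circulation_in_iff[OF wf]
  have inv: "?c (?c E) = E" if "circulation_in E D" for E
    by (rule pair_pre_digraph.equality) (use that in \<open>auto simp: circ\<close>)
  have diff: "card {e \<in> parcs (?c E). P e} = card {e \<in> parcs D. P e} - card {e \<in> parcs E. P e}"
    if "parcs E \<subseteq> parcs D" for P E
  proof -
    have "{e \<in> parcs (?c E). P e} = {e \<in> parcs D. P e} - {e \<in> parcs E. P e}" by auto
    moreover have "finite {e \<in> parcs E. P e}" using fin finite_subset[OF that] by simp
    moreover have "{e \<in> parcs E. P e} \<subseteq> {e \<in> parcs D. P e}" using that by auto
    ultimately show ?thesis by (simp only: card_Diff_subset)
  qed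
  have closed: "circulation_in (?c E) D" if "circulation_in E D" for E
  proof -
    have E: "parcs E \<subseteq> parcs D" "\<And>v. v \<in> pverts D \<Longrightarrow> in_degree E v = out_degree E v"
      using that by (simp_all add: circ)
    have "in_degree (?c E) v = out_degree (?c E) v" if "v \<in> pverts D" for v
      using bal[OF that] E(2)[OF that] by (simp only: in_degree_eq_card out_degree_eq_card diff[OF E(1)])
    then show ?thesis by (auto simp: circ)
  qed
  have parity: "even (card (parcs (?c E))) \<longleftrightarrow> odd (card (parcs E))" if "circulation_in E D" for E
  proof -
    have "parcs E \<subseteq> parcs D" using that by (simp add: circ)
    then have "card (parcs (?c E)) + card (parcs E) = card (parcs D)"
      using fin finite_subset card_mono by (fastforce simp: card_Diff_subset)
    with \<open>odd (card (parcs D))\<close> show ?thesis by presburger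
  qed
  have "bij_betw ?c (even_circulations D) (odd_circulations D)"
    by (rule bij_betw_byWitness[where f' = ?c])
      (use inv closed parity in \<open>auto simp: even_circulations_def odd_circulations_def\<close>)
  then show ?thesis by (rule bij_betw_same_card)
qed

section \<open>Counting flows through the layers modulo 2\<close>

text \<open>A set \<open>h\<close> encodes an orientation of the cycle: the edge from \<open>i\<close> to \<open>i + 1\<close> is oriented forward iff
  \<open>i \<in> h\<close>. With the vertical edges pointing down at the columns in \<open>X\<close> below the layer and in \<open>Y\<close> above it,
  the equation says that every indegree is 2.\<close>

definition layer_flows :: "nat \<Rightarrow> nat set \<Rightarrow> nat set \<Rightarrow> nat set set" where
  "layer_flows m X Y = {h. h \<subseteq> {..<m} \<and> (\<forall>i<m.
     of_bool (i \<in> h) + of_bool (Suc i mod m \<in> Y) =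
     (of_bool (Suc i mod m \<in> h) + of_bool (Suc i mod m \<in> X) :: nat))}"

lemma layer_flowsD:
  assumes "h \<in> layer_flows m X Y" "i < m"
  shows "of_bool (i \<in> h) + of_bool (Suc i mod m \<in> Y) =
    (of_bool (Suc i mod m \<in> h) + of_bool (Suc i mod m \<in> X) :: nat)"
  using assms unfolding layer_flows_def by simp

lemma finite_layer_flows: "finite (layer_flows m X Y)"
  by (rule finite_subset[of _ "Pow {..<m}"]) (auto simp: layer_flows_def)

lemma sum_cyclic_shift: "(\<Sum>i<m. f (Suc i mod m)) = (\<Sum>i<m. f i :: nat)"
proof (cases m)
  case (Suc k)
  have "(\<Sum>i<k. f (Suc i mod Suc k)) = (\<Sum>i<k. f (Suc i))" by (rule sum.cong) auto
  then have "(\<Sum>i<Suc k. f (Suc i mod Suc k)) = (\<Sum>i<k. f (Suc i)) + f 0" by simp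
  also have "\<dots> = (\<Sum>i<Suc k. f i)" by (subst sum.lessThan_Suc_shift) simp
  finally show ?thesis using Suc by simp
qed simp

lemma sum_of_bool_subset:
  fixes m :: nat
  assumes "h \<subseteq> {..<m}"
  shows "(\<Sum>i<m. of_bool (i \<in> h) :: nat) = card h"
  using assms by (simp add: of_bool_def sum.If_cases Int_absorb1)

text \<open>Summing the balance equation around the cycle cancels the contribution of
  \<open>h\<close>. Hence the number of downward edges is the same below and above every
  layer.\<close>

lemma layer_flows_card:
  assumes "h \<in> layer_flows m X Y" "X \<subseteq> {..<m}" "Y \<subseteq> {..<m}"
  shows "card Y = card X"
proof -
  have h: "h \<subseteq> {..<m}" using assms(1) by (simp add: layer_flows_def)
  have "(\<Sum>i<m. of_bool (i \<in> h) + of_bool (Suc i mod m \<in> Y) :: nat) =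
      (\<Sum>i<m. of_bool (Suc i mod m \<in> h) + of_bool (Suc i mod m \<in> X))"
    using layer_flowsD[OF assms(1)] by (intro sum.cong) auto
  then have "(\<Sum>i<m. of_bool (i \<in> h)) + (\<Sum>i<m. of_bool (i \<in> Y)) =
      (\<Sum>i<m. of_bool (i \<in> h)) + (\<Sum>i<m. of_bool (i \<in> X) :: nat)"
    unfolding sum.distrib sum_cyclic_shift[of "\<lambda>i. of_bool (i \<in> h)"]
      sum_cyclic_shift[of "\<lambda>i. of_bool (i \<in> X)"] sum_cyclic_shift[of "\<lambda>i. of_bool (i \<in> Y)"] .
  then show ?thesis using assms(2,3) by (simp only: sum_of_bool_subset add_left_cancel)
qed

lemma cyclic_pred:
  assumes "x < m"
  obtains i where "i < m" "Suc i mod m = x"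
proof (cases x)
  case 0
  then show ?thesis using that[of "m - 1"] assms by simp
next
  case (Suc i)
  then show ?thesis using that[of i] assms by simp
qed

text \<open>By the balance equation the difference of the two indicator functions is constant around
  the cycle, and it vanishes at \<open>x\<close>.\<close>

lemma layer_flows_unique:
  assumes "h \<in> layer_flows m X Y" "h' \<in> layer_flows m X Y"
    and "x < m" "x \<notin> h" "x \<notin> h'"
  shows "h = h'"
proof -
  define d where "d i = int (of_bool (i \<in> h)) - int (of_bool (i \<in> h'))" for i
  have diff: "int b - int b' = int a - int a'" if "a + s = b + t" "a' + s = b' + t"
    for a b a' b' s t :: nat
    using that by linarith
  have d: "d i = d 0" if "i < m" for i
  proof (rule constant_around_cycle[where P = d, OF _ that])
    fix i assume "i < m"
    then show "d (Suc i mod m) = d i"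
      unfolding d_def using diff[OF layer_flowsD[OF assms(1)] layer_flowsD[OF assms(2)]] by blast
  qed
  have "d x = 0" using assms(4,5) by (simp add: d_def)
  then have "d i = 0" if "i < m" for i using d[OF that] d[OF assms(3)] by simp
  then have "i \<in> h \<longleftrightarrow> i \<in> h'" if "i < m" for i
    using that by (cases "i \<in> h"; cases "i \<in> h'") (fastforce simp: d_def)+
  moreover have "h \<subseteq> {..<m}" "h' \<subseteq> {..<m}" using assms(1,2) by (auto simp: layer_flows_def)
  ultimately show ?thesis by blast
qed

text \<open>Going around the cycle, membership in \<open>h\<close> switches on at \<open>y\<close>
  and off at \<open>x\<close>. So \<open>h\<close> is the cyclic interval from \<open>y\<close> up
  to, but excluding, \<open>x\<close>, which is \<open>h0\<close>.\<close>

lemma card_layer_flows_neq: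
  assumes "x < m" "y < m" "x \<noteq> y"
  shows "card (layer_flows m {x} {y}) = 1"
proof -
  define h0 where "h0 = (if y < x then {y..<x} else {..<x} \<union> {y..<m})"
  have "h0 \<in> layer_flows m {x} {y}"
    using assms by (auto simp: layer_flows_def h0_def Suc_mod_eq of_bool_def)
  moreover have x: "x \<notin> h" if "h \<in> layer_flows m {x} {y}" for h
  proof -
    obtain i where "i < m" "Suc i mod m = x" using cyclic_pred[OF assms(1)] .
    with assms(3) have "of_bool (i \<in> h) = (of_bool (x \<in> h) + 1 :: nat)"
      using layer_flowsD[OF that, of i] by simp
    then show ?thesis by (auto simp: of_bool_def split: if_splits)
  qed
  ultimately have "layer_flows m {x} {y} = {h0}"
    using layer_flows_unique[OF _ _ assms(1)] by blast
  then show ?thesis by simp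
qed

text \<open>The vertical terms cancel, so membership in \<open>h\<close> is constant: the layer is
  one of the two directed cycles.\<close>

lemma card_layer_flows_eq:
  assumes "x < m"
  shows "card (layer_flows m {x} {x}) = 2"
proof -
  have "h = {} \<or> h = {..<m}" if "h \<in> layer_flows m {x} {x}" for h
  proof -
    have "(Suc i mod m \<in> h) = (i \<in> h)" if "i < m" for i
      using layer_flowsD[OF \<open>h \<in> _\<close> that] by (cases "i \<in> h"; cases "Suc i mod m \<in> h") simp_all
    then have "i \<in> h \<longleftrightarrow> 0 \<in> h" if "i < m" for i
      using constant_around_cycle[where P = "\<lambda>i. i \<in> h", OF _ that] by blast
    moreover have "h \<subseteq> {..<m}" using \<open>h \<in> _\<close> by (simp add: layer_flows_def)
    ultimately show ?thesis by (cases "0 \<in> h") auto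
  qed
  moreover have "{} \<in> layer_flows m {x} {x}" "{..<m} \<in> layer_flows m {x} {x}"
    using assms by (auto simp: layer_flows_def)
  ultimately have "layer_flows m {x} {x} = {{}, {..<m}}" by blast
  moreover have "{..<m} \<noteq> {}" using assms by auto
  ultimately show ?thesis by (simp add: card_insert_if)
qed

text \<open>Layers are listed from the bottom up. In an entry \<open>(h, Z)\<close>,
  \<open>h\<close> orients the cycle of the layer and \<open>Z\<close> holds the columns whose
  vertical edge just above it points down.\<close>

fun is_flow :: "nat \<Rightarrow> nat set \<Rightarrow> nat set \<Rightarrow> (nat set \<times> nat set) list \<Rightarrow> bool" where
  "is_flow m X Y [] \<longleftrightarrow> X = Y"
| "is_flow m X Y ((h, Z) # r) \<longleftrightarrow> Z \<subseteq> {..<m} \<and> h \<in> layer_flows m X Z \<and> is_flow m Z Y r"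

definition flows :: "nat \<Rightarrow> nat \<Rightarrow> nat set \<Rightarrow> nat set \<Rightarrow> (nat set \<times> nat set) list set" where
  "flows m n X Y = {xs. length xs = n \<and> is_flow m X Y xs}"

text \<open>Prepending \<open>X\<close> shifts the indices: entry \<open>j\<close> of
  \<open>X # map snd xs\<close> is the set below layer \<open>j\<close>, while
  \<open>snd (xs ! j)\<close> is the set above it.\<close>

lemma is_flow_nth:
  "is_flow m X Y xs \<longleftrightarrow>
    (\<forall>j<length xs. snd (xs ! j) \<subseteq> {..<m} \<and>
      fst (xs ! j) \<in> layer_flows m ((X # map snd xs) ! j) (snd (xs ! j))) \<and>
    last (X # map snd xs) = Y"
proof (induction xs arbitrary: X)
  case (Cons a xs)
  obtain h Z where a: "a = (h, Z)" by fastforce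
  have "last (X # map snd (a # xs)) = last (Z # map snd xs)" by (simp add: a)
  then show ?case
    unfolding a length_Cons All_less_Suc2 by (simp add: Cons.IH del: last.simps)
qed simp

lemma finite_flows: "finite (flows m n X Y)"
proof (rule finite_subset)
  show "flows m n X Y \<subseteq> {xs. set xs \<subseteq> Pow {..<m} \<times> Pow {..<m} \<and> length xs = n}"
    by (fastforce simp: flows_def is_flow_nth in_set_conv_nth layer_flows_def)
  show "finite {xs. set xs \<subseteq> Pow {..<m} \<times> Pow {..<m} \<and> length xs = n}"
    by (intro finite_lists_length_eq) simp
qed

text \<open>One step of the transfer matrix: the set above the first layer has as many elements as
  \<open>{x}\<close>, so it is again a singleton \<open>{z}\<close>.\<close>

lemma card_flows_Suc:
  assumes "x < m"
  shows "card (flows m (Suc n) {x} Y) =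
    (\<Sum>z<m. card (layer_flows m {x} {z}) * card (flows m n {z} Y))"
proof -
  let ?c = "\<lambda>z (h, r). (h, {z}) # r"
  have "flows m (Suc n) {x} Y = (\<Union>z<m. ?c z ` (layer_flows m {x} {z} \<times> flows m n {z} Y))"
    (is "?l = ?r")
  proof
    show "?l \<subseteq> ?r"
    proof
      fix xs assume xs: "xs \<in> ?l"
      then obtain h Z r where r: "xs = (h, Z) # r" "length r = n"
        by (auto simp: flows_def length_Suc_conv)
      with xs have *: "Z \<subseteq> {..<m}" "h \<in> layer_flows m {x} Z" "is_flow m Z Y r"
        by (auto simp: flows_def)
      then have "card Z = 1" using layer_flows_card[OF *(2) _ *(1)] assms by simp
      then obtain z where "Z = {z}" by (rule card_1_singletonE)
      with * r show "xs \<in> ?r" by (force simp: flows_def)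
    qed
  qed (auto simp: flows_def)
  moreover have "card \<dots> = (\<Sum>z<m. card (?c z ` (layer_flows m {x} {z} \<times> flows m n {z} Y)))"
    by (rule card_UN_disjoint) (auto simp: finite_layer_flows finite_flows)
  moreover have "card (?c z ` (layer_flows m {x} {z} \<times> flows m n {z} Y)) =
      card (layer_flows m {x} {z}) * card (flows m n {z} Y)" for z
    by (subst card_image) (auto simp: inj_on_def card_cartesian_product)
  ultimately show ?thesis by simp
qed

text \<open>Modulo 2 the recursion counts the intermediate columns \<open>z\<close> different from
  \<open>x\<close> and \<open>y\<close>. There are \<open>m - 2\<close> of them, an odd number, if
  \<open>x \<noteq> y\<close>, and \<open>m - 1\<close>, an even number, if
  \<open>x = y\<close>.\<close>

lemma odd_card_flows:
  assumes "odd m" "x < m" "y < m"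
  shows "odd (card (flows m (Suc n) {x} {y})) \<longleftrightarrow> x \<noteq> y"
  using assms(2)
proof (induction n arbitrary: x)
  case 0
  have "flows m 0 {z} {y} = (if z = y then {[]} else {})" for z
    by (auto simp: flows_def)
  then have "card (flows m (Suc 0) {x} {y}) =
      (\<Sum>z<m. if z = y then card (layer_flows m {x} {z}) else 0)"
    unfolding card_flows_Suc[OF 0] by (intro sum.cong) auto
  also have "\<dots> = card (layer_flows m {x} {y})" using assms(3) by simp
  finally show ?case
    using card_layer_flows_neq[OF 0 assms(3)] card_layer_flows_eq[OF 0] by (cases "x = y") auto
next
  case (Suc n)
  have "odd (card (layer_flows m {x} {z}) * card (flows m (Suc n) {z} {y})) \<longleftrightarrow> z \<noteq> x \<and> z \<noteq> y"
    if "z < m" for z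
    using card_layer_flows_neq[OF Suc.prems that] card_layer_flows_eq[OF Suc.prems]
      Suc.IH[OF that] by (cases "z = x") auto
  then have "{z \<in> {..<m}. odd (card (layer_flows m {x} {z}) * card (flows m (Suc n) {z} {y}))} =
      {..<m} - {x, y}" by auto
  then have "odd (card (flows m (Suc (Suc n)) {x} {y})) \<longleftrightarrow> odd (card ({..<m} - {x, y}))"
    unfolding card_flows_Suc[OF Suc.prems] by (simp only: even_sum_iff finite_lessThan)
  also have "card ({..<m} - {x, y}) = m - card {x, y}"
    using Suc.prems assms(3) by (subst card_Diff_subset) auto
  also have "odd (m - card {x, y}) \<longleftrightarrow> x \<noteq> y"
    using assms Suc.prems by (cases "x = y") auto
  finally show ?case .
qed

section \<open>Orientations of the prism\<close>

abbreviation prism :: "nat \<Rightarrow> nat \<Rightarrow> (nat \<times> nat) pair_pre_digraph" where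
  "prism m n \<equiv> cycle_graph m \<box> path_graph n"

lemma pverts_prism: "pverts (prism m n) = {..<m} \<times> {..<n}"
  by (simp add: cartesian_product_def cycle_graph_def path_graph_def)

lemma pair_graph_prism: "3 \<le> m \<Longrightarrow> pair_graph (prism m n)"
  by (intro pair_graph_cartesian_product pair_graph_cycle_graph pair_graph_path_graph)

lemma prism_arc_iff:
  "((i, j), (i', j')) \<in> parcs (prism m n) \<longleftrightarrow> i < m \<and> i' < m \<and> j < n \<and> j' < n \<and>
    (i = i' \<and> (j' = Suc j \<or> j = Suc j') \<or> j = j' \<and> (i' = Suc i mod m \<or> i = Suc i' mod m))"
  by (auto simp: cartesian_product_def cycle_graph_def path_graph_def)

lemma prism_arc_cases:
  assumes "e \<in> parcs (prism m n)"
  obtains (forward) i j where "i < m" "j < n" "e = ((i, j), (Suc i mod m, j))"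
  | (backward) i j where "i < m" "j < n" "e = ((Suc i mod m, j), (i, j))"
  | (up) i j where "i < m" "Suc j < n" "e = ((i, j), (i, Suc j))"
  | (down) i j where "i < m" "Suc j < n" "e = ((i, Suc j), (i, j))"
proof -
  obtain i j i' j' where e: "e = ((i, j), (i', j'))" by (metis surj_pair)
  show thesis
    using assms forward[of i j] backward[of i' j] up[of i j] down[of i j']
    unfolding e prism_arc_iff by blast
qed

lemma Suc_mod_inj:
  assumes "i < m" "i' < m" "Suc i mod m = Suc i' mod m"
  shows "i = i'"
  using assms by (simp add: Suc_mod_eq split: if_splits)

lemma Suc_Suc_mod_neq:
  assumes "3 \<le> m" "i < m"
  shows "Suc (Suc i mod m) mod m \<noteq> i"
  using assms by (cases "Suc i = m"; cases "Suc (Suc i) = m") auto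

lemma Suc_mod_neq:
  assumes "3 \<le> m" "i < m"
  shows "Suc i mod m \<noteq> i"
  using assms by (cases "Suc i = m") auto

text \<open>Writing the column as the successor \<open>s\<close> of \<open>i\<close> names both
  horizontal neighbors without modular subtraction.\<close>

lemma prism_in_neighbours:
  assumes "i < m" "j < n"
  defines "s \<equiv> Suc i mod m"
  shows "{e \<in> parcs (prism m n). snd e = (s, j)} =
    {((i, j), (s, j)), ((Suc s mod m, j), (s, j))} \<union>
    (if 0 < j then {((s, j - 1), (s, j))} else {}) \<union>
    (if Suc j < n then {((s, Suc j), (s, j))} else {})" (is "?l = ?r")
proof
  have s: "s < m" "Suc s mod m < m" using assms by auto
  show "?l \<subseteq> ?r"
  proof
    fix e assume e: "e \<in> ?l"
    then have "e \<in> parcs (prism m n)" by simp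
    then show "e \<in> ?r"
    proof (cases rule: prism_arc_cases)
      case (forward i' j')
      then have "i' = i" using e Suc_mod_inj[of i' m i] assms by (auto simp: s_def)
      then show ?thesis using forward e by auto
    qed (use e in auto)
  qed
  show "?r \<subseteq> ?l"
    using s assms(1,2) by (auto simp: prism_arc_iff s_def)
qed

lemma in_degree_prism:
  fixes D :: "(nat \<times> nat) pair_pre_digraph"
  assumes "3 \<le> m" "i < m" "j < n" "parcs D \<subseteq> parcs (prism m n)"
  defines "s \<equiv> Suc i mod m"
  shows "in_degree D (s, j) =
    of_bool (((i, j), (s, j)) \<in> parcs D) + of_bool (((Suc s mod m, j), (s, j)) \<in> parcs D) +
    of_bool (0 < j \<and> ((s, j - 1), (s, j)) \<in> parcs D) +
    of_bool (Suc j < n \<and> ((s, Suc j), (s, j)) \<in> parcs D)"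
proof -
  let ?N = "{e \<in> parcs (prism m n). snd e = (s, j)}"
  \<comment> \<open>With at least three columns the two horizontal neighbors of \<open>s\<close> are
    distinct, so no term of the sum over \<open>?N\<close> is counted twice.\<close>
  have ne: "i \<noteq> s" "i \<noteq> Suc s mod m" "Suc s mod m \<noteq> s"
    using Suc_mod_neq[OF assms(1,2)] Suc_Suc_mod_neq[OF assms(1,2)] Suc_mod_neq[OF assms(1), of s]
      assms(1) unfolding s_def by fastforce+
  have N: "?N = {((i, j), (s, j)), ((Suc s mod m, j), (s, j))} \<union>
    (if 0 < j then {((s, j - 1), (s, j))} else {}) \<union>
    (if Suc j < n then {((s, Suc j), (s, j))} else {})"
    unfolding s_def by (rule prism_in_neighbours[OF assms(2,3)])
  have "finite ?N" unfolding N by auto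
  have "{e \<in> parcs D. snd e = (s, j)} = ?N \<inter> parcs D" using assms(4) by auto
  then have "in_degree D (s, j) = (\<Sum>e\<in>?N \<inter> parcs D. 1)" by (simp add: in_degree_eq_card)
  also have "\<dots> = (\<Sum>e\<in>?N. of_bool (e \<in> parcs D))"
    unfolding of_bool_def by (rule sum.inter_restrict[OF \<open>finite ?N\<close>])
  also have "\<dots> = of_bool (((i, j), (s, j)) \<in> parcs D) +
      of_bool (((Suc s mod m, j), (s, j)) \<in> parcs D) +
    of_bool (0 < j \<and> ((s, j - 1), (s, j)) \<in> parcs D) +
    of_bool (Suc j < n \<and> ((s, Suc j), (s, j)) \<in> parcs D)"
    unfolding N using ne by (cases "0 < j"; cases "Suc j < n") simp_all
  finally show ?thesis .
qed

section \<open>Encoding orientations of the prism as flows\<close>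

definition hor :: "nat \<Rightarrow> (nat \<times> nat) pair_pre_digraph \<Rightarrow> nat \<Rightarrow> nat set" where
  "hor m D j = {i. i < m \<and> ((i, j), (Suc i mod m, j)) \<in> parcs D}"

definition down :: "nat \<Rightarrow> (nat \<times> nat) pair_pre_digraph \<Rightarrow> nat \<Rightarrow> nat set" where
  "down m D j = {i. i < m \<and> ((i, Suc j), (i, j)) \<in> parcs D}"

lemma orientation_arc_iff:
  assumes "orientation_of D G" "(u, v) \<in> parcs G"
  shows "(u, v) \<in> parcs D \<longleftrightarrow> (v, u) \<notin> parcs D"
  using assms by (auto simp: orientation_of_def)

lemma orientation_arcs:
  assumes D: "orientation_of D (prism m n)" and i: "i < m"
  shows "j < n \<Longrightarrow> ((i, j), (Suc i mod m, j)) \<in> parcs D \<longleftrightarrow> i \<in> hor m D j"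
    and "j < n \<Longrightarrow> ((Suc i mod m, j), (i, j)) \<in> parcs D \<longleftrightarrow> i \<notin> hor m D j"
    and "Suc j < n \<Longrightarrow> ((i, Suc j), (i, j)) \<in> parcs D \<longleftrightarrow> i \<in> down m D j"
    and "Suc j < n \<Longrightarrow> ((i, j), (i, Suc j)) \<in> parcs D \<longleftrightarrow> i \<notin> down m D j"
proof -
  show *: "((i, j), (Suc i mod m, j)) \<in> parcs D \<longleftrightarrow> i \<in> hor m D j"
    "((i, Suc j), (i, j)) \<in> parcs D \<longleftrightarrow> i \<in> down m D j" for j
    using i by (simp_all add: hor_def down_def)
  show "((Suc i mod m, j), (i, j)) \<in> parcs D \<longleftrightarrow> i \<notin> hor m D j" if "j < n"
    using orientation_arc_iff[OF D, of "(Suc i mod m, j)" "(i, j)"] i that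
    unfolding *(1)[symmetric] by (simp add: prism_arc_iff)
  show "((i, j), (i, Suc j)) \<in> parcs D \<longleftrightarrow> i \<notin> down m D j" if "Suc j < n"
    using orientation_arc_iff[OF D, of "(i, j)" "(i, Suc j)"] i that
    unfolding *(2)[symmetric] by (simp add: prism_arc_iff)
qed

text \<open>The two correction terms are virtual vertical arcs: those below layer 0 point up except at
  column \<open>f\<close>, and above layer \<open>n - 1\<close> only the one at column \<open>e\<close> points down.\<close>

definition balanced_orientations ::
    "nat \<Rightarrow> nat \<Rightarrow> nat \<Rightarrow> nat \<Rightarrow> (nat \<times> nat) pair_pre_digraph set" where
  "balanced_orientations m n f e = {D. orientation_of D (prism m n) \<and>
    (\<forall>i<m. \<forall>j<n. in_degree D (i, j) + of_bool (j = 0 \<and> i \<noteq> f) + of_bool (Suc j = n \<and> i = e) = 2)}"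

text \<open>No edges lie above the top layer; its second component is the virtual downward arc at
  \<open>e\<close>, as the end condition of \<open>flows\<close> demands.\<close>

definition encode :: "nat \<Rightarrow> nat \<Rightarrow> nat \<Rightarrow> (nat \<times> nat) pair_pre_digraph \<Rightarrow> (nat set \<times> nat set) list" where
  "encode m n e D = map (\<lambda>j. (hor m D j, if Suc j = n then {e} else down m D j)) [0..<n]"

definition decode :: "nat \<Rightarrow> nat \<Rightarrow> (nat set \<times> nat set) list \<Rightarrow> (nat \<times> nat) pair_pre_digraph" where
  "decode m n xs = \<lparr> pverts = {..<m} \<times> {..<n}, parcs = {((i, j), (i', j')).
     ((i, j), (i', j')) \<in> parcs (prism m n) \<and>
     (if j = j' then i' = Suc i mod m \<and> i \<in> fst (xs ! j) \<or> i = Suc i' mod m \<and> i' \<notin> fst (xs ! j)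
      else if j = Suc j' then i \<in> snd (xs ! j') else i \<notin> snd (xs ! j))} \<rparr>"

lemma decode_arcs:
  assumes m: "3 \<le> m" and i: "i < m"
  shows "j < n \<Longrightarrow> ((i, j), (Suc i mod m, j)) \<in> parcs (decode m n xs) \<longleftrightarrow> i \<in> fst (xs ! j)"
    and "j < n \<Longrightarrow> ((Suc i mod m, j), (i, j)) \<in> parcs (decode m n xs) \<longleftrightarrow> i \<notin> fst (xs ! j)"
    and "Suc j < n \<Longrightarrow> ((i, Suc j), (i, j)) \<in> parcs (decode m n xs) \<longleftrightarrow> i \<in> snd (xs ! j)"
    and "Suc j < n \<Longrightarrow> ((i, j), (i, Suc j)) \<in> parcs (decode m n xs) \<longleftrightarrow> i \<notin> snd (xs ! j)"
  using i Suc_Suc_mod_neq[OF m i] Suc_Suc_mod_neq[OF m i, symmetric]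
  by (simp_all add: decode_def prism_arc_iff)

lemma orientation_decode:
  assumes "3 \<le> m"
  shows "orientation_of (decode m n xs) (prism m n)"
  unfolding orientation_of_def
proof (intro conjI ballI)
  show "pverts (decode m n xs) = pverts (prism m n)" by (simp add: decode_def pverts_prism)
  show "parcs (decode m n xs) \<subseteq> parcs (prism m n)" by (auto simp: decode_def)
  fix e assume "e \<in> parcs (prism m n)"
  then show "case e of (u, v) \<Rightarrow> (u, v) \<in> parcs (decode m n xs) \<longleftrightarrow> (v, u) \<notin> parcs (decode m n xs)"
    by (cases rule: prism_arc_cases) (simp_all add: decode_arcs[OF assms])
qed

lemma decode_encode:
  assumes m: "3 \<le> m" and D: "orientation_of D (prism m n)"
  shows "decode m n (encode m n e D) = D"
proof (rule pair_pre_digraph.equality)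
  have "a \<in> parcs (decode m n (encode m n e D)) \<longleftrightarrow> a \<in> parcs D" if "a \<in> parcs (prism m n)" for a
    using that
  proof (cases rule: prism_arc_cases)
  qed (simp_all add: decode_arcs[OF m] orientation_arcs[OF D], simp_all add: encode_def)
  moreover have "parcs (decode m n (encode m n e D)) \<subseteq> parcs (prism m n)"
    by (auto simp: decode_def)
  ultimately show "parcs (decode m n (encode m n e D)) = parcs D"
    using D by (fastforce simp: orientation_of_def)
qed (use D in \<open>simp_all add: decode_def orientation_of_def pverts_prism\<close>)

text \<open>Decoding forgets elements outside \<open>{..<m}\<close> and the second component of the
  last entry; the flow condition rules out the former and forces the latter to be
  \<open>{e}\<close>.\<close>

lemma encode_decode:
  assumes m: "3 \<le> m" and xs: "xs \<in> flows m n X {e}"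
  shows "encode m n e (decode m n xs) = xs"
proof (rule nth_equalityI)
  have len: "length xs = n" and nth: "\<And>j. j < n \<Longrightarrow> snd (xs ! j) \<subseteq> {..<m} \<and>
      fst (xs ! j) \<in> layer_flows m ((X # map snd xs) ! j) (snd (xs ! j))"
    and last: "last (X # map snd xs) = {e}"
    using xs by (auto simp: flows_def is_flow_nth)
  show "length (encode m n e (decode m n xs)) = length xs" by (simp add: encode_def len)
  fix j assume "j < length (encode m n e (decode m n xs))"
  then have j: "j < n" by (simp add: encode_def)
  have "fst (xs ! j) \<subseteq> {..<m}" using nth[OF j] by (simp add: layer_flows_def)
  then have "hor m (decode m n xs) j = fst (xs ! j)"
    using decode_arcs(1)[OF m _ j] by (auto simp: hor_def)
  moreover have "(if Suc j = n then {e} else down m (decode m n xs) j) = snd (xs ! j)"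
  proof (cases "Suc j = n")
    case True
    then have "last (X # map snd xs) = snd (xs ! j)"
      using len by (auto simp: last_conv_nth)
    then show ?thesis using last True by simp
  next
    case False
    then show ?thesis
      using decode_arcs(3)[OF m, of _ j n xs] nth[OF j] j by (auto simp: down_def)
  qed
  ultimately have "(hor m (decode m n xs) j,
      if Suc j = n then {e} else down m (decode m n xs) j) = xs ! j"
    by (simp only: prod.collapse)
  then show "encode m n e (decode m n xs) ! j = xs ! j"
    using j by (cases "Suc j = n") (simp_all add: encode_def)
qed

lemma all_Suc_mod_iff: "(\<forall>i<m. P (Suc i mod m)) \<longleftrightarrow> (\<forall>i<m. P i)"
  by (metis cyclic_pred mod_less_divisor neq0_conv not_less0)

text \<open>Let \<open>i\<close> be the column before \<open>s\<close>. With virtual arcs included,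
  the indegree of \<open>(s, j)\<close> counts how many of \<open>i \<in> h\<close>,
  \<open>s \<notin> h\<close>, \<open>s \<notin> X j\<close> and \<open>s \<in> Y j\<close> hold,
  where \<open>h = hor m D j\<close>. This is 2 exactly when the layer equation holds at
  \<open>i\<close>.\<close>

lemma encode_in_flows_iff:
  assumes m: "3 \<le> m" and fe: "f < m" "e < m" and n: "0 < n" and D: "orientation_of D (prism m n)"
  shows "encode m n e D \<in> flows m n {f} {e} \<longleftrightarrow> D \<in> balanced_orientations m n f e"
proof -
  define X where "X j = (if j = 0 then {f} else down m D (j - 1))" for j
  define Y where "Y j = (if Suc j = n then {e} else down m D j)" for j
  let ?xs = "encode m n e D"
  have nth: "?xs ! j = (hor m D j, Y j)" "({f} # map snd ?xs) ! j = X j" if "j < n" for j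
    using that by (auto simp: encode_def Y_def X_def nth_Cons split: nat.split)
  have last: "last ({f} # map snd ?xs) = {e}"
    using n by (simp add: encode_def last_map)
  have sub: "Y j \<subseteq> {..<m}" "hor m D j \<subseteq> {..<m}" for j
    using fe by (auto simp: Y_def down_def hor_def)
  have arcs: "parcs D \<subseteq> parcs (prism m n)" using D by (simp add: orientation_of_def)
  define bal where "bal j s \<longleftrightarrow>
    in_degree D (s, j) + of_bool (j = 0 \<and> s \<noteq> f) + of_bool (Suc j = n \<and> s = e) = 2" for j s
  have deg: "bal j (Suc i mod m) \<longleftrightarrow>
      of_bool (i \<in> hor m D j) + of_bool (Suc i mod m \<in> Y j) =
        (of_bool (Suc i mod m \<in> hor m D j) + of_bool (Suc i mod m \<in> X j) :: nat)"
    if "i < m" "j < n" for i j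
  proof -
    define s where "s = Suc i mod m"
    have s: "s < m" using m by (simp add: s_def)
    have "0 < j \<Longrightarrow> ((s, j - 1), (s, j)) \<in> parcs D \<longleftrightarrow> s \<notin> down m D (j - 1)"
      using orientation_arcs(4)[OF D s, of "j - 1"] that by simp
    then have "in_degree D (s, j) = of_bool (i \<in> hor m D j) + of_bool (s \<notin> hor m D j) +
        of_bool (0 < j \<and> s \<notin> down m D (j - 1)) + of_bool (Suc j < n \<and> s \<in> down m D j)"
      using in_degree_prism[OF m that arcs] orientation_arcs[OF D that(1)]
        orientation_arcs[OF D s] that unfolding s_def[symmetric] by (simp cong: conj_cong)
    moreover have "of_bool (0 < j \<and> s \<notin> down m D (j - 1)) + of_bool (j = 0 \<and> s \<noteq> f) =
        (of_bool (s \<notin> X j) :: nat)"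
      by (simp add: X_def)
    moreover have "of_bool (Suc j < n \<and> s \<in> down m D j) + of_bool (Suc j = n \<and> s = e) =
        (of_bool (s \<in> Y j) :: nat)"
      using that by (auto simp: Y_def)
    ultimately have "in_degree D (s, j) + of_bool (j = 0 \<and> s \<noteq> f) + of_bool (Suc j = n \<and> s = e) =
        of_bool (i \<in> hor m D j) + of_bool (s \<notin> hor m D j) + of_bool (s \<notin> X j) + of_bool (s \<in> Y j)"
      by linarith
    then show ?thesis
      unfolding s_def[symmetric] bal_def
      by (cases "i \<in> hor m D j"; cases "s \<in> hor m D j"; cases "s \<in> X j"; cases "s \<in> Y j") simp_all
  qed
  have "?xs \<in> flows m n {f} {e} \<longleftrightarrow> (\<forall>j<n. hor m D j \<in> layer_flows m (X j) (Y j))"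
    using sub(1) last by (auto simp: flows_def is_flow_nth nth encode_def[THEN arg_cong[of _ _ length]])
  also have "\<dots> \<longleftrightarrow> (\<forall>j<n. \<forall>i<m. bal j (Suc i mod m))"
    using sub(2) deg by (simp add: layer_flows_def)
  also have "\<dots> \<longleftrightarrow> (\<forall>j<n. \<forall>i<m. bal j i)"
    unfolding all_Suc_mod_iff ..
  also have "\<dots> \<longleftrightarrow> D \<in> balanced_orientations m n f e"
    using D unfolding balanced_orientations_def bal_def by blast
  finally show ?thesis .
qed

lemma card_balanced_orientations:
  assumes "3 \<le> m" "f < m" "e < m" "0 < n"
  shows "card (balanced_orientations m n f e) = card (flows m n {f} {e})"
proof (rule bij_betw_same_card)
  have ori: "orientation_of D (prism m n)" if "D \<in> balanced_orientations m n f e" for D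
    using that by (simp add: balanced_orientations_def)
  show "bij_betw (encode m n e) (balanced_orientations m n f e) (flows m n {f} {e})"
  proof (rule bij_betw_byWitness[where f' = "decode m n"])
    show "encode m n e ` balanced_orientations m n f e \<subseteq> flows m n {f} {e}"
      using encode_in_flows_iff[OF assms] ori by blast
    show "decode m n ` flows m n {f} {e} \<subseteq> balanced_orientations m n f e"
      using encode_in_flows_iff[OF assms orientation_decode[OF assms(1)]] encode_decode[OF assms(1)]
      by fastforce
  qed (use ori decode_encode encode_decode assms in auto)
qed

section \<open>Chromatic and list chromatic numbers of odd prisms\<close>

lemma proper_coloring_prism_iff:
  "proper_coloring (prism m n) f \<longleftrightarrow>
    (\<forall>j<n. \<forall>i<m. f (Suc i mod m, j) \<noteq> f (i, j)) \<and>
    (\<forall>j. Suc j < n \<longrightarrow> (\<forall>i<m. f (i, Suc j) \<noteq> f (i, j)))" (is "?l \<longleftrightarrow> ?r")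
proof
  assume l: ?l
  show ?r
  proof (intro conjI allI impI)
    fix i j assume "j < n" "i < m"
    then have "((Suc i mod m, j), (i, j)) \<in> parcs (prism m n)" by (auto simp: prism_arc_iff)
    with l show "f (Suc i mod m, j) \<noteq> f (i, j)" by (auto simp: proper_coloring_def)
  next
    fix i j assume "Suc j < n" "i < m"
    then have "((i, Suc j), (i, j)) \<in> parcs (prism m n)" by (auto simp: prism_arc_iff)
    with l show "f (i, Suc j) \<noteq> f (i, j)" by (auto simp: proper_coloring_def)
  qed
next
  assume r: ?r
  show ?l unfolding proper_coloring_def
  proof
    fix e assume "e \<in> parcs (prism m n)"
    then show "case e of (u, v) \<Rightarrow> f u \<noteq> f v"
      by (cases rule: prism_arc_cases) (use r in \<open>simp_all add: eq_commute\<close>)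
  qed
qed

lemma odd_prism_coloring_ge_3:
  assumes "odd m" "0 < n" "proper_coloring (prism m n) f" "\<forall>v\<in>pverts (prism m n). f v < k"
  shows "3 \<le> k"
  by (rule odd_cycle_not_2_colorable[of m "\<lambda>i. f (i, 0)"])
    (use assms in \<open>auto simp: proper_coloring_prism_iff pverts_prism\<close>)

lemma odd_prism_3_choosable:
  fixes L :: "nat \<times> nat \<Rightarrow> nat set"
  assumes "odd m" "1 < m" "0 < n" and L: "\<forall>v\<in>pverts (prism m n). finite (L v) \<and> 3 \<le> card (L v)"
  shows "\<exists>f. proper_coloring (prism m n) f \<and> (\<forall>v\<in>pverts (prism m n). f v \<in> L v)"
proof -
  have "3 \<le> card (L (i, j))" if "i < m" "j \<le> n - 1" for i j
    using L that assms(3) by (auto simp: pverts_prism)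
  then obtain F where F: "\<forall>j\<le>n - 1. \<forall>i<m. F j i \<in> L (i, j) \<and> F j (Suc i mod m) \<noteq> F j i"
    "\<forall>j<n - 1. \<forall>i<m. F (Suc j) i \<noteq> F j i"
    using odd_prism_list_coloring[OF assms(1,2), of "n - 1" "\<lambda>j i. L (i, j)"] by blast
  show ?thesis
    using F by (intro exI[of _ "\<lambda>(i, j). F j i"]) (auto simp: proper_coloring_prism_iff pverts_prism)
qed

text \<open>Both numbers are 3: the constant lists \<open>{..<k}\<close> turn choosability into
  colorability, and an odd cycle layer needs three colors.\<close>

lemma chromatic_choosable_odd_prism:
  assumes "odd m" "1 < m" "0 < n"
  shows "chromatic_choosable (prism m n)"
proof -
  let ?G = "prism m n"
  have "\<exists>f. proper_coloring ?G f \<and> (\<forall>v\<in>pverts ?G. f v < 3)"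
    using odd_prism_3_choosable[OF assms, of "\<lambda>_. {..<3}"] by auto
  then have "chromatic_number ?G = 3"
    unfolding chromatic_number_def
    using odd_prism_coloring_ge_3[OF assms(1,3)] by (intro Least_equality) blast+
  moreover have "list_chromatic_number ?G = 3"
    unfolding list_chromatic_number_def
  proof (rule Least_equality)
    fix k assume k: "\<forall>L :: nat \<times> nat \<Rightarrow> nat set.
      (\<forall>v\<in>pverts ?G. finite (L v) \<and> k \<le> card (L v)) \<longrightarrow>
      (\<exists>f. proper_coloring ?G f \<and> (\<forall>v\<in>pverts ?G. f v \<in> L v))"
    obtain f where "proper_coloring ?G f" "\<forall>v\<in>pverts ?G. f v < k"
      using k[rule_format, of "\<lambda>_. {..<k}"] by auto
    then show "3 \<le> k" by (rule odd_prism_coloring_ge_3[OF assms(1,3)])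
  qed (use odd_prism_3_choosable[OF assms] in blast)
  ultimately show ?thesis by (simp add: chromatic_choosable_def)
qed

section \<open>The Alon-Tarsi number of odd prisms\<close>

lemma prism_in_degree:
  assumes "3 \<le> m" "i < m" "j < n"
  shows "in_degree (prism m n) (i, j) = 2 + of_bool (0 < j) + of_bool (Suc j < n)"
proof -
  obtain i' where i': "i' < m" "Suc i' mod m = i" using cyclic_pred[OF assms(2)] .
  show ?thesis
    using in_degree_prism[OF assms(1) i'(1) assms(3) order_refl] assms i'
    by (cases j) (simp_all add: prism_arc_iff)
qed

text \<open>If all indegrees are at most 1, then, all total degrees being at least 2, no indegree
  exceeds the outdegree. Both sum to the number of arcs, so they agree everywhere and every total
  degree is 2. This forces a single layer with \<open>m\<close> arcs, and \<open>m\<close> is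
  odd.\<close>

lemma max_indegree_ge_2:
  assumes m: "odd m" "3 \<le> m" and n: "0 < n" and D: "orientation_of D (prism m n)"
    and neq: "card (even_circulations D) \<noteq> card (odd_circulations D)"
  shows "2 \<le> max_indegree D"
proof (rule ccontr)
  assume less: "\<not> 2 \<le> max_indegree D"
  note wf = orientation_wf[OF D pair_graph_prism[OF m(2)]]
  have V: "pverts D = {..<m} \<times> {..<n}" using D by (simp add: orientation_of_def pverts_prism)
  have in_le: "in_degree D v \<le> 1" if "v \<in> pverts D" for v
  proof -
    have "in_degree D v \<le> max_indegree D"
      unfolding max_indegree_def using wf(3) that by (intro Max_ge) auto
    then show ?thesis using less by simp
  qed
  have deg: "in_degree D v + out_degree D v = in_degree (prism m n) v" for v
    by (rule degree_orientation[OF D pair_graph_prism[OF m(2)]])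
  have deg_ge: "2 \<le> in_degree (prism m n) v" if "v \<in> pverts D" for v
    using prism_in_degree[OF m(2)] that by (auto simp: V)
  have io: "in_degree D v \<le> out_degree D v" if "v \<in> pverts D" for v
    using in_le[OF that] deg_ge[OF that] deg[of v] by linarith
  have bal: "in_degree D v = out_degree D v" if "v \<in> pverts D" for v
  proof (rule ccontr)
    assume "\<not> ?thesis"
    then have "in_degree D v < out_degree D v" using io[OF that] by simp
    then have "(\<Sum>v\<in>pverts D. in_degree D v) < (\<Sum>v\<in>pverts D. out_degree D v)"
      using wf(3) io that by (intro sum_strict_mono_ex1) auto
    then show False using sum_in_degree[OF wf] by simp
  qed
  have one: "in_degree D v = 1 \<and> in_degree (prism m n) v = 2" if "v \<in> pverts D" for v
    using bal[OF that] in_le[OF that] deg_ge[OF that] deg[of v] by linarith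
  have "(0, 0) \<in> pverts D" using m n by (auto simp: V)
  \<comment> \<open>A second layer would give \<open>(0, 0)\<close> a third neighbor.\<close>
  from one[OF this] have "n = 1"
    using prism_in_degree[of m 0 0 n] m n by auto
  have "card (parcs D) = (\<Sum>v\<in>pverts D. 1)"
    using sum_in_degree(1)[OF wf] one by simp
  then have "card (parcs D) = m" using \<open>n = 1\<close> by (simp add: V)
  then have "card (even_circulations D) = card (odd_circulations D)"
    using even_odd_circulations_eq[OF wf(1,2) _ bal] m(1) by simp
  with neq show False by simp
qed

lemma exists_prism_orientation:
  assumes m: "odd m" "3 \<le> m" and n: "0 < n"
  shows "\<exists>D. orientation_of D (prism m n) \<and> max_indegree D = 2 \<and>
    card (even_circulations D) \<noteq> card (odd_circulations D)"
proof -
  obtain n' where n': "n = Suc n'" using n gr0_implies_Suc by blast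
  \<comment> \<open>The columns 0 and 1 serve as \<open>f\<close> and \<open>e\<close>; being
    distinct, they make the count odd.\<close>
  have odd: "odd (card (balanced_orientations m n 0 1))"
    using card_balanced_orientations[OF m(2), of 0 1 n] odd_card_flows[OF m(1), of 0 1 n'] m n
    by (simp add: n')
  then have "balanced_orientations m n 0 1 \<noteq> {}" by (metis card.empty even_zero)
  then obtain D where D: "orientation_of D (prism m n)"
    and bal: "\<And>i j. i < m \<Longrightarrow> j < n \<Longrightarrow>
      in_degree D (i, j) + of_bool (j = 0 \<and> i \<noteq> 0) + of_bool (Suc j = n \<and> i = 1) = 2"
    by (auto simp: balanced_orientations_def)
  have V: "pverts D = {..<m} \<times> {..<n}" using D by (simp add: orientation_of_def pverts_prism)
  have "max_indegree D = 2"
    unfolding max_indegree_def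
  proof (rule Max_eqI)
    show "finite (in_degree D ` pverts D)" by (simp add: V)
    show "y \<le> 2" if "y \<in> in_degree D ` pverts D" for y
      using that bal by (fastforce simp: V)
    \<comment> \<open>Neither correction applies at \<open>(0, 0)\<close>, even for
      \<open>n = 1\<close>, since column 0 is \<open>f\<close> and differs from \<open>e\<close>; so
      the bound 2 is attained.\<close>
    have "in_degree D (0, 0) = 2" using bal[of 0 0] m n by simp
    moreover have "(0, 0) \<in> pverts D" using m n by (auto simp: V)
    ultimately show "2 \<in> in_degree D ` pverts D" by force
  qed
  moreover have "{D'. orientation_of D' (prism m n) \<and>
      (\<forall>v\<in>pverts (prism m n). in_degree D' v = in_degree D v)} = balanced_orientations m n 0 1"
  proof -
    have "(\<forall>v\<in>pverts (prism m n). in_degree D' v = in_degree D v) \<longleftrightarrow>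
      (\<forall>i<m. \<forall>j<n. in_degree D' (i, j) + of_bool (j = 0 \<and> i \<noteq> 0) + of_bool (Suc j = n \<and> i = 1) = 2)"
      for D'
    proof -
      have eqv: "in_degree D' (i, j) = in_degree D (i, j) \<longleftrightarrow>
          in_degree D' (i, j) + of_bool (j = 0 \<and> i \<noteq> 0) + of_bool (Suc j = n \<and> i = 1) = 2"
        if "i < m" "j < n" for i j
        using bal[OF that] by linarith
      have "(\<forall>v\<in>pverts (prism m n). in_degree D' v = in_degree D v) \<longleftrightarrow>
          (\<forall>i<m. \<forall>j<n. in_degree D' (i, j) = in_degree D (i, j))"
        by (auto simp: pverts_prism)
      then show ?thesis using eqv by blast
    qed
    then show ?thesis unfolding balanced_orientations_def by blast
  qed
  ultimately show ?thesis
    using even_odd_circulations_neq[OF D pair_graph_prism[OF m(2)]] odd D by auto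
qed

theorem theorem4:
  fixes k n :: nat
  assumes "k \<ge> 1" and "n \<ge> 1"
  shows "AT (cycle_graph (2 * k + 1) \<box> path_graph n) = 3 \<and>
    chromatic_choosable (cycle_graph (2 * k + 1) \<box> path_graph n)"
proof
  have m: "odd (2 * k + 1)" "3 \<le> 2 * k + 1" "1 < 2 * k + 1" and n: "0 < n"
    using assms by simp_all
  show "AT (prism (2 * k + 1) n) = 3"
    unfolding AT_def
  proof (rule Least_equality)
    show "\<exists>D. orientation_of D (prism (2 * k + 1) n) \<and> max_indegree D + 1 = 3 \<and>
        card (even_circulations D) \<noteq> card (odd_circulations D)"
      using exists_prism_orientation[OF m(1,2) n] by auto
    fix l assume "\<exists>D. orientation_of D (prism (2 * k + 1) n) \<and> max_indegree D + 1 = l \<and>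
        card (even_circulations D) \<noteq> card (odd_circulations D)"
    then show "3 \<le> l" using max_indegree_ge_2[OF m(1,2) n] by fastforce
  qed
  show "chromatic_choosable (prism (2 * k + 1) n)"
    by (rule chromatic_choosable_odd_prism[OF m(1,3) n])
qed

end
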